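(* Let $R$ be a commutative ring with unity such that for each maximal ideal $\mathcal{M}$, $\mathcal{M}^i\neq\mathcal{M}^{i+1}$ for all $i\ge0$ and $\bigcap_{i\ge0}\mathcal{M}^i=(0)$, and such that every nonzero element of $R$ is contained in only finitely many maximal ideals. Let $\mathcal{F}$ be a finite set of maximal ideals and $\mathit{M}(\mathcal{F})$ the monoid generated by $\mathcal{F}$. Then there exists a map $\Sigma:\mathit{M}(\mathcal{F})\to R$ with $\Sigma(\mathcal{I})\neq0$ for all $\mathcal{I}$ such that: (1) $\Sigma(R)=1$; (2) $\Sigma(\mathcal{I})\in\mathcal{S}_{\mathcal{I}}$ for all $\mathcal{I}\in\mathit{M}(\mathcal{F})$; (3) if $\mathcal{I},\mathcal{J}\in\mathit{M}(\mathcal{F})$ are comaximal then $\Sigma(\mathcal{I}\mathcal{J})=\Sigma(\mathcal{I})\Sigma(\mathcal{J})$; (4) for $\mathcal{I}_1,\dots,\mathcal{I}_r\in\mathit{M}(\mathcal{F})$, if $\mathcal{I}_1+\dots+\mathcal{I}_r=R$ then $(\Sigma(\mathcal{I}_1))+\dots+(\Sigma(\mathcal{I}_r))=R$.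
   Context: $\mathit{M}(\mathcal{F})$ is the set of finite products of ideals in $\mathcal{F}$ ($R$ being the empty product), $\mathit{M}(\mathcal{F})^*=\mathit{M}(\mathcal{F})\setminus\{R\}$, and for $\mathcal{I}\in\mathit{M}(\mathcal{F})$, $\mathcal{S}_{\mathcal{I}}=\mathcal{I}\setminus\bigcup_{\mathcal{J}\in\mathit{M}(\mathcal{F})^*}\mathcal{I}\mathcal{J}$. *)

theory Defs
  imports "HOL-Algebra.Algebra"
begin

text \<open>Products and powers of ideals are those of the semiring \<^const>\<open>ideals_set\<close>, whose
  unit is \<^term>\<open>carrier R\<close> and whose zero is the zero ideal. Repetitions in the list are allowed,
  so that this is the monoid generated by \<^term>\<open>F\<close>.\<close>

definition ideal_monoid :: "('a, 'b) ring_scheme \<Rightarrow> 'a set set \<Rightarrow> 'a set set"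
  where "ideal_monoid R F = {foldr (ideal_prod R) Js (carrier R) | Js. set Js \<subseteq> F}"

definition ideal_monoid_star :: "('a, 'b) ring_scheme \<Rightarrow> 'a set set \<Rightarrow> 'a set set"
  where "ideal_monoid_star R F = ideal_monoid R F - {carrier R}"

definition S_set :: "('a, 'b) ring_scheme \<Rightarrow> 'a set set \<Rightarrow> 'a set \<Rightarrow> 'a set"
  where "S_set R F I = I - (\<Union>J \<in> ideal_monoid_star R F. ideal_prod R I J)"

definition comaximal :: "('a, 'b) ring_scheme \<Rightarrow> 'a set \<Rightarrow> 'a set \<Rightarrow> bool"
  where "comaximal R I J \<longleftrightarrow> I <+>\<^bsub>R\<^esub> J = carrier R"

end

theory Submission
  imports Defs
begin

text \<open>
  An element \<open>\<Sigma>(\<Prod> M^(e_M))\<close> is sought in the form \<open>\<Prod> s(M, e_M)\<close>, where \<open>s(M, 0) = 1\<close> and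
  \<open>s(M, e)\<close> lies in \<open>M^e\<close>, but neither in \<open>M^(e+1)\<close> nor in any other member of \<open>F\<close>; powers of \<open>M\<close>
  being \<open>M\<close>-primary, such products lie in the right sets \<open>S_I\<close>, and multiplicativity is immediate.
  For the last property no maximal ideal may contain both \<open>s(M, e)\<close> and \<open>s(N, f)\<close> with
  \<open>M \<noteq> N\<close>. As there are only countably many pairs \<open>(M, e)\<close>, the \<open>s(M, e)\<close> are chosen one after
  the other: each has to avoid the finitely many maximal ideals other than \<open>M\<close> that belong to
  \<open>F\<close> or contain an earlier choice. If then a maximal ideal contains all
  \<open>\<Sigma>(I_k)\<close>, the factors responsible for that all belong to the same \<open>M\<close>, which therefore
  contains all \<open>I_k\<close>.
\<close>

section \<open>Elementary facts on ideals and maximal ideals\<close>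

declare Group.nat_pow_0 [simp del] Group.nat_pow_Suc [simp del]

lemma ideals_set_simps:
  "carrier (ideals_set R) = {I. ideal I R}"
  "monoid.mult (ideals_set R) = ideal_prod R"
  "one (ideals_set R) = carrier R"
  "ring.zero (ideals_set R) = {\<zero>\<^bsub>R\<^esub>}"
  "add (ideals_set R) = set_add R"
  by (simp_all add: ideals_set_def)

lemma (in ring) ideal_zero_closed: "ideal K R \<Longrightarrow> \<zero> \<in> K"
  by (simp add: additive_subgroup.zero_closed ideal.axioms(1))

lemma (in ring) ideal_add_closed: "\<lbrakk>ideal K R; x \<in> K; y \<in> K\<rbrakk> \<Longrightarrow> x \<oplus> y \<in> K"
  by (simp add: additive_subgroup.a_closed ideal.axioms(1))

lemma (in ring) ideal_minus_closed: "\<lbrakk>ideal K R; x \<in> K; y \<in> K\<rbrakk> \<Longrightarrow> x \<ominus> y \<in> K"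
  unfolding a_minus_def
  by (intro ideal_add_closed additive_subgroup.a_inv_closed[OF ideal.axioms(1)])

text \<open>Zorn's lemma on the ideals above \<open>K\<close>. Properness is expressed as not
  containing \<open>\<one>\<close>, a condition that unions of chains visibly inherit.\<close>

lemma (in cring) exists_maximalideal_superset:
  assumes "ideal K R" "K \<noteq> carrier R"
  shows "\<exists>M. maximalideal M R \<and> K \<subseteq> M"
proof -
  let ?A = "{J. ideal J R \<and> K \<subseteq> J \<and> \<one> \<notin> J}"
  have "\<one> \<notin> K"
    using assms ideal.one_imp_carrier by blast
  then have "?A \<noteq> {}"
    using assms by blast
  moreover have "\<Union>\<C> \<in> ?A" if \<C>: "\<C> \<noteq> {}" "subset.chain ?A \<C>" for \<C>
  proof -
    have sub: "\<C> \<subseteq> ?A" and tot: "I \<subseteq> I' \<or> I' \<subseteq> I" if "I \<in> \<C>" "I' \<in> \<C>" for I I'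
      using \<C> that by (auto simp: subset.chain_def subset_iff_psubset_eq)
    have C_ideal: "ideal J R" if "J \<in> \<C>" for J
      using sub that by blast
    have "ideal (\<Union>\<C>) R"
    proof (rule idealI[OF ring_axioms])
      show "subgroup (\<Union>\<C>) (add_monoid R)"
      proof (rule add.subgroupI)
        show "\<Union>\<C> \<subseteq> carrier R"
          using ideal.Icarr[OF C_ideal] by blast
        obtain J where "J \<in> \<C>"
          using \<C> by blast
        then have "\<zero> \<in> J"
          by (intro ideal_zero_closed[OF C_ideal])
        then show "\<Union>\<C> \<noteq> {}"
          using \<open>J \<in> \<C>\<close> by blast
      next
        fix a assume "a \<in> \<Union>\<C>"
        then obtain J where J: "J \<in> \<C>" "a \<in> J" by blast
        then have "\<ominus> a \<in> J"
          by (intro additive_subgroup.a_inv_closed[OF ideal.axioms(1)[OF C_ideal]])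
        then show "\<ominus> a \<in> \<Union>\<C>"
          using J by blast
      next
        fix a b assume "a \<in> \<Union>\<C>" "b \<in> \<Union>\<C>"
        then obtain I I' where "I \<in> \<C>" "a \<in> I" "I' \<in> \<C>" "b \<in> I'" by blast
        then obtain L where L: "L \<in> \<C>" "a \<in> L" "b \<in> L"
          using tot by blast
        then have "a \<oplus> b \<in> L"
          by (intro ideal_add_closed[OF C_ideal])
        then show "a \<oplus> b \<in> \<Union>\<C>"
          using L by blast
      qed
    qed (use ideal.I_l_closed[OF C_ideal] ideal.I_r_closed[OF C_ideal] in blast)+
    then show ?thesis
      using sub \<C> by blast
  qed
  ultimately have "\<exists>M\<in>?A. \<forall>J\<in>?A. M \<subseteq> J \<longrightarrow> J = M"
    by (rule subset_Zorn_nonempty)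
  then obtain M where M: "M \<in> ?A" and max: "\<forall>J\<in>?A. M \<subseteq> J \<longrightarrow> J = M"
    by (rule bexE)
  have "maximalideal M R"
  proof (rule maximalidealI)
    show "J = M \<or> J = carrier R" if J: "ideal J R" "M \<subseteq> J" for J
    proof (cases "\<one> \<in> J")
      case False
      then have "J \<in> ?A"
        using M J by auto
      then show ?thesis
        using max J(2) by blast
    qed (use ideal.one_imp_carrier[OF J(1)] in simp)
  qed (use M in auto)
  then show ?thesis
    using M by auto
qed

lemma (in cring) maximalideal_subset_eq:
  assumes "maximalideal M R" "maximalideal N R" "M \<subseteq> N"
  shows "M = N"
  using assms maximalideal.I_maximal[of M R N] maximalideal.I_notcarr[of N R]
  by (metis additive_subgroup.a_subset ideal_def maximalideal.axioms(1))

text \<open>Primality of \<open>M\<close>, extended from two factors to finitely many. It is mostly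
  used contrapositively: a product inside \<open>M\<close> has a factor inside
  \<open>M\<close>.\<close>

lemma (in cring) finprod_notin_maximalideal:
  assumes "maximalideal M R" "f \<in> A \<rightarrow> carrier R" "\<And>a. a \<in> A \<Longrightarrow> f a \<notin> M"
  shows "finprod R f A \<notin> M"
proof -
  interpret primeideal M R
    using assms maximalideal_prime by blast
  have "\<one> \<notin> M"
    using I_notcarr one_imp_carrier by blast
  then show ?thesis
    using assms(2,3)
  proof (induction A rule: infinite_finite_induct)
    case (insert a A)
    then have "f a \<in> carrier R" "finprod R f A \<in> carrier R"
      by auto
    moreover have "finprod R f (insert a A) = f a \<otimes> finprod R f A"
      using insert by (intro finprod_insert) auto
    ultimately show ?case
      using I_prime[of "f a" "finprod R f A"] insert by auto
  qed auto
qed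

section \<open>Powers of ideals, in particular of maximal ideals\<close>

lemma (in cring) ideal_pow_0: "I [^]\<^bsub>ideals_set R\<^esub> (0::nat) = carrier R"
  by (simp add: ideals_set_simps Group.nat_pow_0)

lemma (in cring) ideal_pow_Suc:
  "I [^]\<^bsub>ideals_set R\<^esub> Suc n = (I [^]\<^bsub>ideals_set R\<^esub> n) \<cdot> I"
  by (simp add: ideals_set_simps Group.nat_pow_Suc)

lemma (in cring) ideal_pow_ideal:
  assumes "ideal I R"
  shows "ideal (I [^]\<^bsub>ideals_set R\<^esub> (n::nat)) R"
proof (induction n)
  case 0
  then show ?case
    by (simp add: ideal_pow_0 oneideal)
next
  case (Suc n)
  then show ?case
    using assms by (simp add: ideal_pow_Suc ideal_prod_is_ideal)
qed

lemma (in cring) ideal_pow_Suc_subset: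
  assumes "ideal I R"
  shows "I [^]\<^bsub>ideals_set R\<^esub> Suc n \<subseteq> I [^]\<^bsub>ideals_set R\<^esub> n"
    and "I [^]\<^bsub>ideals_set R\<^esub> Suc n \<subseteq> I"
  using ideal_prod_inter[OF ideal_pow_ideal[OF assms, of n] assms]
  by (auto simp: ideal_pow_Suc)

lemma (in cring) ideal_pow_antimono:
  assumes "ideal I R" "m \<le> n"
  shows "I [^]\<^bsub>ideals_set R\<^esub> (n::nat) \<subseteq> I [^]\<^bsub>ideals_set R\<^esub> (m::nat)"
  using assms(2)
proof (induction n rule: dec_induct)
  case (step n)
  then show ?case
    using ideal_pow_Suc_subset(1)[OF assms(1)] by blast
qed simp

text \<open>An element outside \<open>M\<close> is a unit modulo \<open>M\<close>, hence modulo each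
  power of \<open>M\<close>. The relation for \<open>n = 1\<close> comes from maximality and is then
  lifted by induction.\<close>

lemma (in cring) maximalideal_pow_unit:
  assumes "maximalideal M R" "u \<in> carrier R" "u \<notin> M"
  shows "\<exists>p\<in>M [^]\<^bsub>ideals_set R\<^esub> (n::nat). \<exists>r\<in>carrier R. p \<oplus> r \<otimes> u = \<one>"
proof -
  interpret maximalideal M R by fact
  let ?K = "M <+>\<^bsub>R\<^esub> PIdl u"
  have K: "ideal ?K R"
    by (rule add_ideals[OF is_ideal cgenideal_ideal[OF assms(2)]])
  have "m \<in> ?K" if "m \<in> M" for m
  proof -
    have "m \<oplus> \<zero> \<in> ?K"
      using that ideal_zero_closed[OF cgenideal_ideal[OF assms(2)]] unfolding set_add_def' by blast
    then show ?thesis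
      using Icarr[OF that] by simp
  qed
  moreover have "u \<in> ?K"
  proof -
    have "\<zero> \<oplus> u \<in> ?K"
      using cgenideal_self[OF assms(2)] ideal_zero_closed[OF is_ideal] unfolding set_add_def' by blast
    then show ?thesis
      using assms(2) by simp
  qed
  \<comment> \<open>\<open>?K\<close> contains \<open>M\<close> and also \<open>u\<close>, so it is
    strictly larger than \<open>M\<close>.\<close>
  ultimately have "?K = carrier R"
    using I_maximal[OF K] ideal.Icarr[OF K] assms(3) by blast
  then have "\<one> \<in> ?K"
    by simp
  then obtain p v where "p \<in> M" "v \<in> PIdl u" "\<one> = p \<oplus> v"
    unfolding set_add_def' by blast
  then obtain r where pr: "p \<in> M" "r \<in> carrier R" "\<one> = p \<oplus> r \<otimes> u"
    unfolding cgenideal_def by blast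
  show ?thesis
  proof (induction n)
    case 0
    have "\<one> \<oplus> \<zero> \<otimes> u = \<one>"
      using assms by simp
    then show ?case
      unfolding ideal_pow_0 by blast
  next
    case (Suc n)
    then obtain q s where qs: "q \<in> M [^]\<^bsub>ideals_set R\<^esub> n" "s \<in> carrier R" "q \<oplus> s \<otimes> u = \<one>"
      by blast
    have c: "q \<in> carrier R" "p \<in> carrier R"
      using qs pr Icarr ideal.Icarr[OF ideal_pow_ideal[OF is_ideal]] by auto
    \<comment> \<open>Substituting \<open>\<one> = p \<oplus> r \<otimes> u\<close> for the
      invisible factor of \<open>q\<close> in \<open>q \<oplus> s \<otimes> u = \<one>\<close>
      pushes the first summand from \<open>M^n\<close> into \<open>M^(n+1)\<close>.\<close>
    have "q \<otimes> p \<oplus> (q \<otimes> r \<oplus> s) \<otimes> u = q \<otimes> (p \<oplus> r \<otimes> u) \<oplus> s \<otimes> u"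
      using c pr(2) qs(2) assms(2) by (simp add: l_distr r_distr m_assoc a_assoc)
    also have "\<dots> = \<one>"
      using c(1) pr(3)[symmetric] qs(3) by simp
    finally have "q \<otimes> p \<oplus> (q \<otimes> r \<oplus> s) \<otimes> u = \<one>" .
    moreover have "q \<otimes> p \<in> M [^]\<^bsub>ideals_set R\<^esub> Suc n"
      unfolding ideal_pow_Suc using qs pr by (intro ideal_prod.prod)
    moreover have "q \<otimes> r \<oplus> s \<in> carrier R"
      using c pr qs by auto
    ultimately show ?case
      by blast
  qed
qed

text \<open>Multiplying a relation \<open>p \<oplus> r \<otimes> u = \<one>\<close> with
  \<open>p\<close> in \<open>M^n\<close> by \<open>x\<close> leaves only terms in
  \<open>M^n\<close>.\<close>

lemma (in cring) maximalideal_pow_primary: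
  assumes M: "maximalideal M R" and u: "u \<in> carrier R" "u \<notin> M"
    and x: "x \<in> carrier R" "u \<otimes> x \<in> M [^]\<^bsub>ideals_set R\<^esub> (n::nat)"
  shows "x \<in> M [^]\<^bsub>ideals_set R\<^esub> n"
proof -
  have id: "ideal (M [^]\<^bsub>ideals_set R\<^esub> n) R"
    using M ideal_pow_ideal maximalideal.axioms(1) by blast
  obtain p r where pr: "p \<in> M [^]\<^bsub>ideals_set R\<^esub> n" "r \<in> carrier R" "p \<oplus> r \<otimes> u = \<one>"
    using maximalideal_pow_unit[OF M u] by blast
  have "p \<in> carrier R"
    using ideal.Icarr[OF id pr(1)] .
  then have "x = p \<otimes> x \<oplus> r \<otimes> (u \<otimes> x)"
    using pr(2,3) u x l_distr[of p "r \<otimes> u" x] by (simp add: m_assoc)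
  then show ?thesis
    using ideal_add_closed[OF id ideal.I_r_closed[OF id pr(1) x(1)] ideal.I_l_closed[OF id x(2) pr(2)]]
    by simp
qed

section \<open>Choice of elements of exact order\<close>

text \<open>A Chinese remainder argument: an element \<open>a\<close> of exact order
  \<open>e\<close> at \<open>M\<close> is modified so as to become \<open>1\<close> modulo the
  finitely many other maximal ideals, without changing its class modulo
  \<open>M^(e+1)\<close>.\<close>

lemma (in cring) exists_exact_order_avoiding:
  assumes M: "maximalideal M R"
    and neq: "M [^]\<^bsub>ideals_set R\<^esub> (e::nat) \<noteq> M [^]\<^bsub>ideals_set R\<^esub> Suc e"
    and T: "finite T" "\<And>N. N \<in> T \<Longrightarrow> maximalideal N R" "M \<notin> T"
  shows "\<exists>s\<in>M [^]\<^bsub>ideals_set R\<^esub> e. s \<notin> M [^]\<^bsub>ideals_set R\<^esub> Suc e \<and> (\<forall>N\<in>T. s \<notin> N)"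
proof -
  have id: "ideal (M [^]\<^bsub>ideals_set R\<^esub> n) R" for n :: nat
    using M ideal_pow_ideal maximalideal.axioms(1) by blast
  have idT: "ideal N R" if "N \<in> T" for N
    using T that maximalideal.axioms(1) by blast
  note incl = ideal_pow_Suc_subset(1)[OF maximalideal.axioms(1)[OF M], of e]
  obtain a where a: "a \<in> M [^]\<^bsub>ideals_set R\<^esub> e" "a \<notin> M [^]\<^bsub>ideals_set R\<^esub> Suc e"
    using neq incl by blast
  have "\<exists>u. u \<in> N \<and> u \<notin> M" if "N \<in> T" for N
    using T that maximalideal_subset_eq[of N M] M by blast
  then obtain w where w: "\<And>N. N \<in> T \<Longrightarrow> w N \<in> N \<and> w N \<notin> M"
    by metis
  have wc: "w \<in> T \<rightarrow> carrier R"
    using w idT ideal.Icarr by fastforce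
  \<comment> \<open>Each \<open>w N\<close> lies in \<open>N\<close> but not in \<open>M\<close>, as
    distinct maximal ideals are incomparable. So \<open>u\<close> lies in every member of
    \<open>T\<close>, and by primality not in \<open>M\<close>.\<close>
  define u where "u = finprod R w T"
  have u: "u \<in> carrier R" "u \<notin> M"
    unfolding u_def using wc w finprod_notin_maximalideal[OF M wc] by auto
  have uN: "u \<in> N" if "N \<in> T" for N
  proof -
    have "u = w N \<otimes> finprod R w (T - {N})"
      unfolding u_def using that T(1) wc finprod_insert[of "T - {N}" N w]
      by (auto simp: insert_absorb Pi_iff)
    moreover have "finprod R w (T - {N}) \<in> carrier R"
      using wc by (intro finprod_closed) auto
    ultimately show ?thesis
      using ideal.I_r_closed[OF idT[OF that]] w[OF that] by simp
  qed
  obtain p r where pr: "p \<in> M [^]\<^bsub>ideals_set R\<^esub> Suc e" "r \<in> carrier R" "p \<oplus> r \<otimes> u = \<one>"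
    using maximalideal_pow_unit[OF M u] by blast
  have c: "p \<in> carrier R" "a \<in> carrier R"
    using ideal.Icarr[OF id pr(1)] ideal.Icarr[OF id a(1)] by auto
  \<comment> \<open>\<open>s\<close> is congruent to \<open>a\<close> modulo \<open>M^(e+1)\<close> and to \<open>1\<close> modulo each ideal in \<open>T\<close>.\<close>
  define s where "s = p \<oplus> r \<otimes> u \<otimes> a"
  have "s \<in> M [^]\<^bsub>ideals_set R\<^esub> e"
    unfolding s_def using a pr u incl
    by (intro ideal_add_closed[OF id] ideal.I_l_closed[OF id]) auto
  moreover have "s \<notin> M [^]\<^bsub>ideals_set R\<^esub> Suc e"
  proof
    assume s: "s \<in> M [^]\<^bsub>ideals_set R\<^esub> Suc e"
    have "r \<otimes> u \<otimes> a = s \<ominus> p"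
      unfolding s_def using c pr(2) u by algebra
    \<comment> \<open>The left side is \<open>a\<close>, because
      \<open>p \<oplus> r \<otimes> u = \<one>\<close>. If \<open>s\<close> were in
      \<open>M^(e+1)\<close>, the right side and thus \<open>a\<close> would be there too.\<close>
    then have "p \<otimes> a \<oplus> r \<otimes> u \<otimes> a = p \<otimes> a \<oplus> (s \<ominus> p)"
      by simp
    moreover have "p \<otimes> a \<oplus> r \<otimes> u \<otimes> a = a"
      using c pr u by (metis l_distr l_one m_closed)
    moreover have "p \<otimes> a \<oplus> (s \<ominus> p) \<in> M [^]\<^bsub>ideals_set R\<^esub> Suc e"
      using s pr(1) c
      by (intro ideal_add_closed[OF id] ideal_minus_closed[OF id] ideal.I_r_closed[OF id])
    ultimately show False
      using a by simp
  qed
  moreover have "s \<notin> N" if N: "N \<in> T" for N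
  proof
    assume s: "s \<in> N"
    have ru: "r \<otimes> u \<in> N"
      using ideal.I_l_closed[OF idT[OF N] uN[OF N] pr(2)] .
    have "s \<ominus> r \<otimes> u \<otimes> a = p"
      unfolding s_def using c pr(2) u by algebra
    then have "(s \<ominus> r \<otimes> u \<otimes> a) \<oplus> r \<otimes> u = \<one>"
      using pr(3) by simp
    moreover have "(s \<ominus> r \<otimes> u \<otimes> a) \<oplus> r \<otimes> u \<in> N"
      using s ideal.I_r_closed[OF idT[OF N] ru c(2)]
      by (intro ideal_add_closed[OF idT[OF N]] ideal_minus_closed[OF idT[OF N]] ru)
    ultimately have "N = carrier R"
      using idT[OF N] ideal.one_imp_carrier by metis
    then show False
      using T(2)[OF N] maximalideal.I_notcarr by blast
  qed
  ultimately show ?thesis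
    by blast
qed


text \<open>The recursion runs along an enumeration of all pairs \<open>(M, e)\<close>. Only
  finitely many choices precede a given one, and each is nonzero because of its exact order, so
  finitely many maximal ideals have to be avoided at every stage.\<close>

lemma (in cring) exists_coprime_elements_of_exact_order:
  fixes F :: "'a set set"
  assumes neq: "\<And>M (i::nat). M \<in> F \<Longrightarrow> M [^]\<^bsub>ideals_set R\<^esub> i \<noteq> M [^]\<^bsub>ideals_set R\<^esub> Suc i"
    and fin: "\<And>x. \<lbrakk>x \<in> carrier R; x \<noteq> \<zero>\<rbrakk> \<Longrightarrow> finite {M. maximalideal M R \<and> x \<in> M}"
    and F: "finite F" "\<And>M. M \<in> F \<Longrightarrow> maximalideal M R"
  obtains s :: "'a set \<Rightarrow> nat \<Rightarrow> 'a"
  where "\<And>M. M \<in> F \<Longrightarrow> s M 0 = \<one>"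
    and "\<And>M e. M \<in> F \<Longrightarrow> s M e \<in> M [^]\<^bsub>ideals_set R\<^esub> e - M [^]\<^bsub>ideals_set R\<^esub> Suc e"
    and "\<And>M N e. \<lbrakk>M \<in> F; N \<in> F; M \<noteq> N\<rbrakk> \<Longrightarrow> s M e \<notin> N"
    and "\<And>M N e f K. \<lbrakk>M \<in> F; N \<in> F; maximalideal K R; s M e \<in> K; s N f \<in> K\<rbrakk> \<Longrightarrow> M = N"
proof -
  define D where "D = F \<times> (UNIV :: nat set)"
  define g where "g = to_nat_on D"
  have g: "inj_on g D"
    unfolding g_def D_def using F(1) by (intro inj_on_to_nat_on) (simp add: countable_finite)
  define bad where
    \<comment> \<open>The maximal ideals that the choice at \<open>y\<close> must avoid. The
      component \<open>fst y\<close> itself is exempt, as it contains the element whenever the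
      exponent is positive.\<close>
    "bad s y = {N. maximalideal N R \<and> N \<noteq> fst y \<and> (N \<in> F \<or> (\<exists>z\<in>D. g z < g y \<and> s z \<in> N))}"
    for s :: "'a set \<times> nat \<Rightarrow> 'a" and y
  define Q where
    "Q s y r \<longleftrightarrow> (y \<in> D \<longrightarrow> (snd y = 0 \<longrightarrow> r = \<one>) \<and>
       r \<in> fst y [^]\<^bsub>ideals_set R\<^esub> snd y - fst y [^]\<^bsub>ideals_set R\<^esub> Suc (snd y) \<and>
       (\<forall>N\<in>bad s y. r \<notin> N))" for s y r
  have id: "ideal (M [^]\<^bsub>ideals_set R\<^esub> (n::nat)) R" if "M \<in> F" for M n
    using F that ideal_pow_ideal maximalideal.axioms(1) by blast
  have one: "\<one> \<notin> M" if "maximalideal M R" for M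
    using that by (metis ideal.one_imp_carrier maximalideal.I_notcarr maximalideal.axioms(1))
  \<comment> \<open>Well-founded recursion applies since \<open>bad s y\<close> consults
    \<open>s\<close> only at indices numbered below \<open>g y\<close>. Outside \<open>D\<close> the
    requirement \<open>Q\<close> is void.\<close>
  have "\<exists>s. \<forall>y. Q s y (s y)"
  proof (rule dependent_wf_choice[of "inv_image less_than g"])
    show "wf (inv_image less_than g)"
      by simp
    show "Q s y r = Q t y r" if "\<And>z. (z, y) \<in> inv_image less_than g \<Longrightarrow> s z = t z" for s t y r
    proof -
      have "bad s y = bad t y"
        unfolding bad_def using that by auto
      then show ?thesis
        unfolding Q_def by simp
    qed
    show "\<exists>r. Q s y r" if prev: "\<And>z. (z, y) \<in> inv_image less_than g \<Longrightarrow> Q s z (s z)" for s y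
    proof (cases "y \<in> D")
      case True
      then obtain M e where y: "y = (M, e)" "M \<in> F"
        by (auto simp: D_def)
      have "finite {z\<in>D. g z < g y}"
      proof (rule inj_on_finite)
        show "inj_on g {z\<in>D. g z < g y}"
          using g by (rule inj_on_subset) auto
        show "g ` {z\<in>D. g z < g y} \<subseteq> {..<g y}"
          by auto
      qed auto
      moreover have "finite {N. maximalideal N R \<and> s z \<in> N}" if "z \<in> D" "g z < g y" for z
      proof (rule fin)
        have M: "fst z \<in> F"
          using that by (auto simp: D_def)
        have "Q s z (s z)"
          using prev that by simp
        then have z: "s z \<in> fst z [^]\<^bsub>ideals_set R\<^esub> snd z" "s z \<notin> fst z [^]\<^bsub>ideals_set R\<^esub> Suc (snd z)"
          using that unfolding Q_def by auto
        show "s z \<in> carrier R"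
          using ideal.Icarr[OF id[OF M] z(1)] .
        show "s z \<noteq> \<zero>"
          using z(2) ideal_zero_closed[OF id[OF M]] by metis
      qed
      \<comment> \<open>This finite set contains \<open>bad s y\<close>.\<close>
      ultimately have "finite (F \<union> (\<Union>z\<in>{z\<in>D. g z < g y}. {N. maximalideal N R \<and> s z \<in> N}))"
        using F(1) by simp
      then have bad_fin: "finite (bad s y)"
        by (rule finite_subset[rotated]) (auto simp: bad_def)
      show ?thesis
      \<comment> \<open>For exponent \<open>0\<close> the value \<open>\<one>\<close> is prescribed.
        It meets all demands, since no maximal ideal contains it.\<close>
      proof (cases "e = 0")
        case True
        have "\<one> \<notin> M [^]\<^bsub>ideals_set R\<^esub> Suc e"
          using ideal_pow_Suc_subset(2)[OF maximalideal.axioms(1)[OF F(2)[OF y(2)]], of e] one[OF F(2)[OF y(2)]]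
          by blast
        moreover have "\<forall>N\<in>bad s y. \<one> \<notin> N"
          using one unfolding bad_def by blast
        ultimately have "Q s y \<one>"
          unfolding Q_def y(1) fst_conv snd_conv True using ideal_pow_0[of M] by simp
        then show ?thesis ..
      next
        case False
        have "\<And>N. N \<in> bad s y \<Longrightarrow> maximalideal N R" "M \<notin> bad s y"
          using y(1) unfolding bad_def by auto
        then obtain r where "r \<in> M [^]\<^bsub>ideals_set R\<^esub> e" "r \<notin> M [^]\<^bsub>ideals_set R\<^esub> Suc e" "\<forall>N\<in>bad s y. r \<notin> N"
          using exists_exact_order_avoiding[OF F(2)[OF y(2)] neq[OF y(2), of e] bad_fin] by metis
        then have "Q s y r"
          unfolding Q_def y(1) fst_conv snd_conv using False by simp
        then show ?thesis ..
      qed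
    qed (auto simp: Q_def)
  qed
  then obtain t where t: "\<And>M e. M \<in> F \<Longrightarrow> Q t (M, e) (t (M, e))"
    by blast
  define s where "s M e = t (M, e)" for M e
  have D: "(M, e) \<in> D" if "M \<in> F" for M e
    using that by (simp add: D_def)
  have avoidF: "s M e \<notin> N" if "M \<in> F" "N \<in> F" "M \<noteq> N" for M N e
  proof -
    have "N \<in> bad t (M, e)"
      unfolding bad_def using F(2) that by auto
    then show ?thesis
      using t[OF that(1), of e] D[OF that(1)] unfolding Q_def s_def by blast
  qed
  \<comment> \<open>The later choice avoided every maximal ideal containing the earlier one, with
    the sole exception of \<open>N\<close>. So if \<open>M\<close> and \<open>N\<close> differ, then
    \<open>K = N\<close>, but \<open>s M e\<close> avoids the members of \<open>F\<close> other than
    \<open>M\<close>.\<close>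
  have earlier: "M = N"
    if "M \<in> F" "N \<in> F" "maximalideal K R" "s M e \<in> K" "s N f \<in> K" "g (M, e) < g (N, f)" for M N e f K
  proof (rule ccontr)
    assume "M \<noteq> N"
    have "K \<notin> bad t (N, f)"
      using t[OF that(2), of f] D[OF that(2)] that(5) unfolding Q_def s_def by blast
    then have "K = N"
      using that(3,4,6) D[OF that(1)] unfolding bad_def s_def by auto
    then show False
      using avoidF[OF that(1,2) \<open>M \<noteq> N\<close>] that(4) by simp
  qed
  show thesis
  proof (rule that[of s])
    show "s M 0 = \<one>" "s M e \<in> M [^]\<^bsub>ideals_set R\<^esub> e - M [^]\<^bsub>ideals_set R\<^esub> Suc e" if "M \<in> F" for M e
      using t[OF that] D[OF that] unfolding Q_def s_def by auto
    show "s M e \<notin> N" if "M \<in> F" "N \<in> F" "M \<noteq> N" for M N e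
      using avoidF that .
    show "M = N" if "M \<in> F" "N \<in> F" "maximalideal K R" "s M e \<in> K" "s N f \<in> K" for M N e f K
    proof -
      consider "g (M, e) = g (N, f)" | "g (M, e) < g (N, f)" | "g (N, f) < g (M, e)"
        by linarith
      then show ?thesis
        using earlier[of M N K e f] earlier[of N M K f e] that inj_onD[OF g, of "(M, e)" "(N, f)"] D
        by cases auto
    qed
  qed
qed

section \<open>Products of ideals and membership in them\<close>

lemma (in cring) ideal_prod_mono:
  assumes "I \<subseteq> I'" "J \<subseteq> J'"
  shows "I \<cdot> J \<subseteq> I' \<cdot> J'"
proof
  show "x \<in> I' \<cdot> J'" if "x \<in> I \<cdot> J" for x
    using that by induction (use assms in \<open>auto intro: ideal_prod.intros\<close>)
qed

lemma (in cring) foldr_ideal_prod_ideal: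
  assumes "\<And>J. J \<in> set Js \<Longrightarrow> ideal J R"
  shows "ideal (foldr (ideal_prod R) Js (carrier R)) R"
  using assms by (induction Js) (auto simp: oneideal ideal_prod_is_ideal)

lemma (in cring) foldr_ideal_prod_append:
  assumes "\<And>J. J \<in> set (Is @ Js) \<Longrightarrow> ideal J R"
  shows "foldr (ideal_prod R) (Is @ Js) (carrier R) =
    foldr (ideal_prod R) Is (carrier R) \<cdot> foldr (ideal_prod R) Js (carrier R)"
  using assms
proof (induction Is)
  case Nil
  then show ?case
    using foldr_ideal_prod_ideal[of Js] ideal_prod_one ideal_prod_commute[OF oneideal] by auto
next
  case (Cons I Is)
  then have "ideal I R" "ideal (foldr (ideal_prod R) Is (carrier R)) R"
    "ideal (foldr (ideal_prod R) Js (carrier R)) R"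
    by (auto intro: foldr_ideal_prod_ideal)
  then show ?case
    using Cons by (simp add: ideal_prod_assoc)
qed

text \<open>Every occurrence of \<open>M\<close> contributes a factor \<open>M\<close>, and the
  other factors can only shrink the product.\<close>

lemma (in cring) foldr_ideal_prod_subset_pow:
  assumes "\<And>J. J \<in> set Js \<Longrightarrow> ideal J R" "ideal M R"
  shows "foldr (ideal_prod R) Js (carrier R) \<subseteq> M [^]\<^bsub>ideals_set R\<^esub> count_list Js M"
  using assms(1)
proof (induction Js)
  case Nil
  then show ?case
    by (simp add: ideal_pow_0)
next
  case (Cons J Js)
  let ?K = "foldr (ideal_prod R) Js (carrier R)"
  have K: "ideal ?K R" "?K \<subseteq> M [^]\<^bsub>ideals_set R\<^esub> count_list Js M" "ideal J R"
    using Cons by (auto intro: foldr_ideal_prod_ideal)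
  show ?case
  proof (cases "J = M")
    case True
    have "J \<cdot> ?K = ?K \<cdot> J"
      using K ideal_prod_commute by blast
    also have "\<dots> \<subseteq> (M [^]\<^bsub>ideals_set R\<^esub> count_list Js M) \<cdot> M"
      using K True ideal_prod_mono by blast
    finally show ?thesis
      using True by (simp add: ideal_pow_Suc)
  next
    case False
    then show ?thesis
      using ideal_prod_inter[OF K(3,1)] K by auto
  qed
qed

text \<open>Collecting equal factors. This turns a list into exponents indexed by \<open>F\<close>,
  the form in which elements can be chosen factor by factor.\<close>

lemma (in cring) foldr_ideal_prod_eq_finprod_pow:
  assumes F: "finite F" "\<And>M. M \<in> F \<Longrightarrow> ideal M R" and "set Js \<subseteq> F"
  shows "foldr (ideal_prod R) Js (carrier R) =
    (\<Otimes>\<^bsub>ideals_set R\<^esub> M\<in>F. M [^]\<^bsub>ideals_set R\<^esub> count_list Js M)"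
  using assms(3)
proof (induction Js)
  interpret IS: comm_monoid "ideals_set R"
    by (rule ideals_set_is_comm_monoid)
  {
    case Nil
    then show ?case
      using IS.finprod_one[of F] by (simp add: ideals_set_simps Group.nat_pow_0)
  next
    case (Cons J Js)
    have c: "M [^]\<^bsub>ideals_set R\<^esub> (n::nat) \<in> carrier (ideals_set R)" if "M \<in> F" for M n
      using ideal_pow_ideal F that by (simp add: ideals_set_simps)
    have J: "J \<in> F" "J \<in> carrier (ideals_set R)"
      using Cons F by (auto simp: ideals_set_simps)
    \<comment> \<open>\<open>J\<close> itself is written as a product over \<open>F\<close>, trivial
      away from the index \<open>J\<close>, so that it can be merged factorwise with the product for
      \<open>Js\<close>.\<close>
    define D where "D M = (if J = M then M else \<one>\<^bsub>ideals_set R\<^esub>)" for M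
    have D: "D M \<in> carrier (ideals_set R)" if "M \<in> F" for M
      unfolding D_def using J by auto
    have D_prod: "(\<Otimes>\<^bsub>ideals_set R\<^esub> M\<in>F. D M) = J"
      unfolding D_def using J F by (intro IS.finprod_singleton) (auto simp: ideals_set_simps)
    have IH: "foldr (ideal_prod R) Js (carrier R) =
        (\<Otimes>\<^bsub>ideals_set R\<^esub> M\<in>F. M [^]\<^bsub>ideals_set R\<^esub> count_list Js M)"
      using Cons by simp
    have "foldr (ideal_prod R) (J # Js) (carrier R) =
        J \<otimes>\<^bsub>ideals_set R\<^esub> (\<Otimes>\<^bsub>ideals_set R\<^esub> M\<in>F. M [^]\<^bsub>ideals_set R\<^esub> count_list Js M)"
      unfolding foldr.simps o_apply IH ideals_set_simps ..
    also have "\<dots> = (\<Otimes>\<^bsub>ideals_set R\<^esub> M\<in>F. D M \<otimes>\<^bsub>ideals_set R\<^esub> M [^]\<^bsub>ideals_set R\<^esub> count_list Js M)"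
      unfolding D_prod[symmetric] using D c by (intro IS.finprod_multf[symmetric]) auto
    also have "\<dots> = (\<Otimes>\<^bsub>ideals_set R\<^esub> M\<in>F. M [^]\<^bsub>ideals_set R\<^esub> count_list (J # Js) M)"
    proof (rule IS.finprod_cong')
      fix M assume M: "M \<in> F"
      show "D M \<otimes>\<^bsub>ideals_set R\<^esub> M [^]\<^bsub>ideals_set R\<^esub> count_list Js M = M [^]\<^bsub>ideals_set R\<^esub> count_list (J # Js) M"
        using c[OF M] J(2) by (auto simp: D_def IS.m_comm Group.nat_pow_Suc)
    qed (use c in auto)
    finally show ?case .
  }
qed

lemma (in cring) finprod_mem_finprod_ideals:
  assumes "finite A" "\<And>a. a \<in> A \<Longrightarrow> ideal (E a) R" "\<And>a. a \<in> A \<Longrightarrow> x a \<in> E a"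
  shows "finprod R x A \<in> finprod (ideals_set R) E A"
  using assms
proof (induction A rule: finite_induct)
  interpret IS: comm_monoid "ideals_set R"
    by (rule ideals_set_is_comm_monoid)
  {
    case empty
    then show ?case
      by (simp add: ideals_set_simps)
  next
    case (insert a A)
    have "finprod (ideals_set R) E (insert a A) = E a \<otimes>\<^bsub>ideals_set R\<^esub> finprod (ideals_set R) E A"
      using insert by (intro IS.finprod_insert) (auto simp: ideals_set_simps)
    also have "\<dots> = E a \<cdot> finprod (ideals_set R) E A"
      by (simp add: ideals_set_simps)
    finally have E: "finprod (ideals_set R) E (insert a A) = E a \<cdot> finprod (ideals_set R) E A" .
    have "x b \<in> carrier R" if "b \<in> insert a A" for b
      using ideal.Icarr[OF insert.prems(1)[OF that] insert.prems(2)[OF that]] .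
    then have "finprod R x (insert a A) = x a \<otimes> finprod R x A"
      using insert.hyps by (intro finprod_insert) auto
    then show ?case
      unfolding E using insert by (auto intro: ideal_prod.prod)
  }
qed

text \<open>The factors other than \<open>x M\<close> have a product outside \<open>M\<close>, which
  can be cancelled because \<open>M^n\<close> is primary.\<close>

lemma (in cring) finprod_notin_ideal_pow:
  assumes F: "finite F" "M \<in> F" "maximalideal M R" and x: "x \<in> F \<rightarrow> carrier R"
    and "x M \<notin> M [^]\<^bsub>ideals_set R\<^esub> (n::nat)" "\<And>N. N \<in> F \<Longrightarrow> N \<noteq> M \<Longrightarrow> x N \<notin> M"
  shows "finprod R x F \<notin> M [^]\<^bsub>ideals_set R\<^esub> n"
proof
  assume *: "finprod R x F \<in> M [^]\<^bsub>ideals_set R\<^esub> n"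
  define u where "u = finprod R x (F - {M})"
  have x': "x \<in> F - {M} \<rightarrow> carrier R"
    using x by auto
  have u: "u \<in> carrier R" "u \<notin> M"
    unfolding u_def using finprod_closed[OF x'] finprod_notin_maximalideal[OF F(3) x'] assms(6) by auto
  have xM: "x M \<in> carrier R"
    using x F(2) by blast
  have "finprod R x F = x M \<otimes> u"
    unfolding u_def using F(1,2) x finprod_insert[of "F - {M}" M x] by (simp add: insert_absorb Pi_iff)
  then have "u \<otimes> x M \<in> M [^]\<^bsub>ideals_set R\<^esub> n"
    using * m_comm[OF xM u(1)] by simp
  then show False
    using maximalideal_pow_primary[OF F(3) u xM] assms(5) by blast
qed

section \<open>Finite sums of ideals\<close>

text \<open>A finite sum of ideals is their supremum: adding one more ideal generates the ideal of
  the union. The three claims share one induction, as each step needs the partial sum to be an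
  ideal.\<close>

lemma (in cring)
  assumes "finite A" "\<And>a. a \<in> A \<Longrightarrow> ideal (E a) R"
  shows finsum_ideals_ideal: "ideal (finsum (ideals_set R) E A) R"
    and finsum_ideals_upper: "\<And>a. a \<in> A \<Longrightarrow> E a \<subseteq> finsum (ideals_set R) E A"
    and finsum_ideals_least:
      "\<And>K. \<lbrakk>ideal K R; \<And>a. a \<in> A \<Longrightarrow> E a \<subseteq> K\<rbrakk> \<Longrightarrow> finsum (ideals_set R) E A \<subseteq> K"
proof -
  interpret IS: semiring "ideals_set R"
    by (rule ideals_set_is_semiring)
  have "ideal (finsum (ideals_set R) E A) R \<and> (\<forall>a\<in>A. E a \<subseteq> finsum (ideals_set R) E A) \<and>
    (\<forall>K. ideal K R \<longrightarrow> (\<forall>a\<in>A. E a \<subseteq> K) \<longrightarrow> finsum (ideals_set R) E A \<subseteq> K)"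
    using assms
  proof (induction A rule: finite_induct)
    case empty
    then show ?case
      using zeroideal ideal_zero_closed by (auto simp: ideals_set_simps)
  next
    case (insert a A)
    let ?S = "finsum (ideals_set R) E A"
    have S: "ideal ?S R" "ideal (E a) R"
      using insert by auto
    have "finsum (ideals_set R) E (insert a A) = E a \<oplus>\<^bsub>ideals_set R\<^esub> ?S"
      using insert by (intro IS.finsum_insert) (auto simp: ideals_set_simps)
    also have "\<dots> = Idl (E a \<union> ?S)"
      using union_genideal[OF S(2,1)] by (simp add: ideals_set_simps)
    finally have eq: "finsum (ideals_set R) E (insert a A) = Idl (E a \<union> ?S)" .
    have sub: "E a \<union> ?S \<subseteq> carrier R"
      using ideal.Icarr[OF S(1)] ideal.Icarr[OF S(2)] by blast
    have IH: "E b \<subseteq> ?S" if "b \<in> A" for b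
      using insert.IH insert.prems that by auto
    have IH2: "?S \<subseteq> K" if "ideal K R" "\<forall>a\<in>A. E a \<subseteq> K" for K
      using insert.IH insert.prems that by auto
    show ?case
      unfolding eq
    proof (intro conjI ballI allI impI)
      show "ideal (Idl (E a \<union> ?S)) R"
        by (rule genideal_ideal[OF sub])
      show "E b \<subseteq> Idl (E a \<union> ?S)" if "b \<in> insert a A" for b
        using genideal_self[OF sub] IH that by blast
      show "Idl (E a \<union> ?S) \<subseteq> K" if "ideal K R" "\<forall>a\<in>insert a A. E a \<subseteq> K" for K
        using IH2 that by (intro genideal_minimal) auto
    qed
  qed
  then show "ideal (finsum (ideals_set R) E A) R"
    and "\<And>a. a \<in> A \<Longrightarrow> E a \<subseteq> finsum (ideals_set R) E A"
    and "\<And>K. \<lbrakk>ideal K R; \<And>a. a \<in> A \<Longrightarrow> E a \<subseteq> K\<rbrakk> \<Longrightarrow> finsum (ideals_set R) E A \<subseteq> K"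
    by blast+
qed

section \<open>Construction of the map and verification of its properties\<close>

theorem mainTheorem10:
  fixes R :: "('a, 'b) ring_scheme" (structure)
    and F :: "'a set set"
  assumes "cring R" and "\<one> \<noteq> \<zero>"
    and "\<And>M (i::nat). maximalideal M R \<Longrightarrow>
           M [^]\<^bsub>ideals_set R\<^esub> i \<noteq> M [^]\<^bsub>ideals_set R\<^esub> (i + 1)"
    and "\<And>M. maximalideal M R \<Longrightarrow> (\<Inter>i::nat. M [^]\<^bsub>ideals_set R\<^esub> i) = {\<zero>}"
    and "\<And>x. \<lbrakk>x \<in> carrier R; x \<noteq> \<zero>\<rbrakk> \<Longrightarrow> finite {M. maximalideal M R \<and> x \<in> M}"
    and "finite F" and "\<And>M. M \<in> F \<Longrightarrow> maximalideal M R"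
  shows "\<exists>\<sigma> \<in> ideal_monoid R F \<rightarrow> carrier R.
           (\<forall>I \<in> ideal_monoid R F. \<sigma> I \<noteq> \<zero>) \<and>
           \<sigma> (carrier R) = \<one> \<and>
           (\<forall>I \<in> ideal_monoid R F. \<sigma> I \<in> S_set R F I) \<and>
           (\<forall>I \<in> ideal_monoid R F. \<forall>J \<in> ideal_monoid R F.
              comaximal R I J \<longrightarrow> \<sigma> (ideal_prod R I J) = \<sigma> I \<otimes> \<sigma> J) \<and>
           (\<forall>(r::nat) (I :: nat \<Rightarrow> 'a set).
              (\<forall>k \<in> {1..r}. I k \<in> ideal_monoid R F) \<longrightarrow>
              (\<Oplus>\<^bsub>ideals_set R\<^esub> k \<in> {1..r}. I k) = carrier R \<longrightarrow>
              (\<Oplus>\<^bsub>ideals_set R\<^esub> k \<in> {1..r}. PIdl (\<sigma> (I k))) = carrier R)"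
proof -
  interpret cring R by fact
  note finF = \<open>finite F\<close> and maxF = assms(7)
  have idF: "ideal M R" if "M \<in> F" for M
    using maxF that maximalideal.axioms(1) by blast
  obtain s :: "'a set \<Rightarrow> nat \<Rightarrow> 'a"
    where s0: "\<And>M. M \<in> F \<Longrightarrow> s M 0 = \<one>"
      and s_ord: "\<And>M e. M \<in> F \<Longrightarrow> s M e \<in> M [^]\<^bsub>ideals_set R\<^esub> e - M [^]\<^bsub>ideals_set R\<^esub> Suc e"
      and s_notin: "\<And>M N e. \<lbrakk>M \<in> F; N \<in> F; M \<noteq> N\<rbrakk> \<Longrightarrow> s M e \<notin> N"
      and s_coprime: "\<And>M N e f K. \<lbrakk>M \<in> F; N \<in> F; maximalideal K R; s M e \<in> K; s N f \<in> K\<rbrakk> \<Longrightarrow> M = N"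
    by (rule exists_coprime_elements_of_exact_order[of F]) (use assms in auto)
  have s_carr: "s M e \<in> carrier R" if "M \<in> F" for M e
    using ideal.Icarr[OF ideal_pow_ideal[OF idF[OF that]]] s_ord[OF that] by blast
  define mk where "mk Js = foldr (ideal_prod R) Js (carrier R)" for Js :: "'a set list"
  define t where "t e = finprod R (\<lambda>M. s M (e M)) F" for e
  \<comment> \<open>The exponent of \<open>M\<close> is read off from the ideal, not from a list of
    factors, so \<open>\<sigma>\<close> is well defined without assuming unique
    factorization.\<close>
  define ord where "ord I M = (LEAST n. \<not> I \<subseteq> M [^]\<^bsub>ideals_set R\<^esub> Suc n)" for I M
  define \<sigma> where "\<sigma> I = t (ord I)" for I
  have mkE: "\<exists>Js. set Js \<subseteq> F \<and> I = mk Js" if "I \<in> ideal_monoid R F" for I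
    using that unfolding ideal_monoid_def mk_def by blast
  have mk_append: "mk (Is @ Js) = mk Is \<cdot> mk Js" if "set Is \<subseteq> F" "set Js \<subseteq> F" for Is Js
    unfolding mk_def using that idF by (intro foldr_ideal_prod_append) auto
  have mk_ideal: "ideal (mk Js) R" if "set Js \<subseteq> F" for Js
    unfolding mk_def using that idF by (intro foldr_ideal_prod_ideal) auto
  have mk_sub: "mk Js \<subseteq> M [^]\<^bsub>ideals_set R\<^esub> count_list Js M" if "set Js \<subseteq> F" "M \<in> F" for Js M
    unfolding mk_def using that idF by (intro foldr_ideal_prod_subset_pow) auto
  have mk_sub_maximal: "mk Js \<subseteq> M"
    if Js: "set Js \<subseteq> F" and M: "M \<in> F" and pos: "count_list Js M \<noteq> 0" for Js M
  proof -
    obtain n where "count_list Js M = Suc n"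
      using pos not0_implies_Suc by blast
    then show ?thesis
      using mk_sub[OF Js M] ideal_pow_Suc_subset(2)[OF idF[OF M], of n] by simp
  qed
  have t_carr: "t e \<in> carrier R" for e
    unfolding t_def using s_carr by (intro finprod_closed) auto
  have t_cong: "t e = t f" if "\<And>M. M \<in> F \<Longrightarrow> e M = f M" for e f
    unfolding t_def using that s_carr by (intro finprod_cong') auto
  have t_mk: "t (count_list Js) \<in> mk Js" if "set Js \<subseteq> F" for Js
  proof -
    have "s M (count_list Js M) \<in> M [^]\<^bsub>ideals_set R\<^esub> count_list Js M" if "M \<in> F" for M
      using s_ord[OF that] by blast
    moreover have "mk Js = (\<Otimes>\<^bsub>ideals_set R\<^esub> M\<in>F. M [^]\<^bsub>ideals_set R\<^esub> count_list Js M)"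
      unfolding mk_def using that finF idF by (intro foldr_ideal_prod_eq_finprod_pow) auto
    ultimately show ?thesis
      unfolding t_def using finF idF by (auto intro!: finprod_mem_finprod_ideals ideal_pow_ideal)
  qed
  \<comment> \<open>This holds for arbitrary exponents \<open>e\<close>, and so also for
    \<open>ord I\<close> when \<open>I\<close> lies outside the monoid.\<close>
  have t_notin: "t e \<notin> M [^]\<^bsub>ideals_set R\<^esub> Suc (e M)" if M: "M \<in> F" for e M
    unfolding t_def
  proof (rule finprod_notin_ideal_pow)
    show "s M (e M) \<notin> M [^]\<^bsub>ideals_set R\<^esub> Suc (e M)"
      using s_ord[OF M] by blast
    show "s N (e N) \<notin> M" if "N \<in> F" "N \<noteq> M" for N
      using s_notin[OF that(1) M that(2)] .
  qed (use M finF maxF s_carr in auto)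
  \<comment> \<open>The element \<open>t (count_list Js)\<close> lies in the product but not in the
    next power of \<open>M\<close>, so it witnesses that the inclusion in
    \<open>M^(count_list Js M)\<close> is sharp. In particular the multiplicities depend only on the
    ideal.\<close>
  have ord_mk: "ord (mk Js) M = count_list Js M" if Js: "set Js \<subseteq> F" and M: "M \<in> F" for Js M
    unfolding ord_def
  proof (rule Least_equality)
    show "\<not> mk Js \<subseteq> M [^]\<^bsub>ideals_set R\<^esub> Suc (count_list Js M)"
      using t_mk[OF Js] t_notin[OF M, of "count_list Js"] by blast
    show "count_list Js M \<le> n" if "\<not> mk Js \<subseteq> M [^]\<^bsub>ideals_set R\<^esub> Suc n" for n
    proof (rule ccontr)
      assume "\<not> count_list Js M \<le> n"
      then show False
        using that mk_sub[OF Js M] ideal_pow_antimono[OF idF[OF M], of "Suc n" "count_list Js M"] by auto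
    qed
  qed
  have \<sigma>_mk: "\<sigma> (mk Js) = t (count_list Js)" if "set Js \<subseteq> F" for Js
    unfolding \<sigma>_def using ord_mk[OF that] by (intro t_cong)
  have "\<sigma> I \<noteq> \<zero>" for I
  \<comment> \<open>Without members of \<open>F\<close> the value is the empty product
    \<open>\<one>\<close>. Otherwise it avoids some power of an \<open>M\<close>, whereas
    \<open>\<zero>\<close> does not.\<close>
  proof (cases "F = {}")
    case True
    then show ?thesis
      using \<open>\<one> \<noteq> \<zero>\<close> unfolding \<sigma>_def t_def by simp
  next
    case False
    then obtain M where M: "M \<in> F"
      by blast
    show ?thesis
      using t_notin[OF M, of "ord I"] ideal_zero_closed[OF ideal_pow_ideal[OF idF[OF M]]]
      unfolding \<sigma>_def by metis
  qed
  moreover have "\<sigma> (carrier R) = \<one>"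
  proof -
    have "\<sigma> (carrier R) = t (\<lambda>_. 0)"
      using \<sigma>_mk[of "[]"] t_cong[of "count_list []" "\<lambda>_. 0"] by (simp add: mk_def)
    also have "\<dots> = \<one>"
      unfolding t_def using s0 by (intro finprod_one_eqI)
    finally show ?thesis .
  qed
  moreover have "\<sigma> I \<in> S_set R F I" if I: "I \<in> ideal_monoid R F" for I
  proof -
    obtain Is where Is: "set Is \<subseteq> F" "I = mk Is"
      using mkE[OF I] by blast
    have "\<sigma> I \<notin> I \<cdot> J" if J: "J \<in> ideal_monoid_star R F" for J
    proof
      assume mem: "\<sigma> I \<in> I \<cdot> J"
      obtain Js where Js: "set Js \<subseteq> F" "J = mk Js"
        using mkE J unfolding ideal_monoid_star_def by blast
      have "Js \<noteq> []"
        using J Js unfolding ideal_monoid_star_def mk_def by auto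
      then obtain M where "M \<in> set Js"
        using hd_in_set by blast
      then have M: "M \<in> F" "count_list Js M \<noteq> 0"
        using Js by (auto simp: count_list_0_iff)
      \<comment> \<open>A factor \<open>M\<close> of \<open>J\<close> raises the exponent of
        \<open>M\<close> beyond that in \<open>I\<close>, and \<open>\<sigma> I\<close> avoids the
        higher power.\<close>
      have "I \<cdot> J \<subseteq> M [^]\<^bsub>ideals_set R\<^esub> count_list (Is @ Js) M"
        using mk_append[of Is Js] mk_sub[of "Is @ Js" M] Is Js M by auto
      also have "\<dots> \<subseteq> M [^]\<^bsub>ideals_set R\<^esub> Suc (count_list Is M)"
        using M by (intro ideal_pow_antimono idF) auto
      finally show False
        using mem \<sigma>_mk t_notin[OF M(1), of "count_list Is"] Is by auto
    qed
    then show ?thesis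
      unfolding S_set_def using t_mk \<sigma>_mk Is by auto
  qed
  moreover have "\<sigma> (I \<cdot> J) = \<sigma> I \<otimes> \<sigma> J"
    if I: "I \<in> ideal_monoid R F" and J: "J \<in> ideal_monoid R F" and co: "comaximal R I J" for I J
  proof -
    obtain Is Js where Is: "set Is \<subseteq> F" "I = mk Is" and Js: "set Js \<subseteq> F" "J = mk Js"
      using mkE I J by meson
    \<comment> \<open>A common \<open>M\<close> would contain \<open>I <+> J\<close>. Hence at each
      \<open>M\<close> one exponent vanishes, and \<open>s M 0 = \<one>\<close> makes
      \<open>s M\<close> multiplicative on the two exponents.\<close>
    have disj: "count_list Is M = 0 \<or> count_list Js M = 0" if M: "M \<in> F" for M
    proof (rule ccontr)
      assume "\<not> ?thesis"
      then have "I \<subseteq> M" "J \<subseteq> M"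
        using mk_sub_maximal Is Js M by auto
      then have "I <+> J \<subseteq> M"
        using ideal_add_closed[OF idF[OF M]] unfolding set_add_def' by blast
      then show False
        using co maximalideal.I_notcarr[OF maxF[OF M]] ideal.Icarr[OF idF[OF M]]
        unfolding comaximal_def by blast
    qed
    have "\<sigma> (I \<cdot> J) = finprod R (\<lambda>M. s M (count_list (Is @ Js) M)) F"
      using \<sigma>_mk[of "Is @ Js"] mk_append Is Js by (simp add: t_def)
    also have "\<dots> = finprod R (\<lambda>M. s M (count_list Is M) \<otimes> s M (count_list Js M)) F"
      using disj s0 s_carr by (intro finprod_cong') force+
    also have "\<dots> = \<sigma> I \<otimes> \<sigma> J"
      using \<sigma>_mk Is Js s_carr by (simp add: t_def Pi_iff)
    finally show ?thesis .
  qed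
  moreover have "(\<Oplus>\<^bsub>ideals_set R\<^esub> k \<in> {1..r}. PIdl (\<sigma> (I k))) = carrier R"
    if I: "\<forall>k \<in> {1..r}. I k \<in> ideal_monoid R F"
      and sum: "(\<Oplus>\<^bsub>ideals_set R\<^esub> k \<in> {1..r}. I k) = carrier R" for r and I :: "nat \<Rightarrow> 'a set"
  proof (rule ccontr)
    let ?K = "\<Oplus>\<^bsub>ideals_set R\<^esub> k \<in> {1..r}. PIdl (\<sigma> (I k))"
    have \<sigma>_carr: "\<sigma> (I k) \<in> carrier R" for k
      unfolding \<sigma>_def by (rule t_carr)
    have PIdl_ideal: "ideal (PIdl (\<sigma> (I k))) R" for k
      using cgenideal_ideal \<sigma>_carr .
    assume "?K \<noteq> carrier R"
    moreover have "ideal ?K R"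
      using PIdl_ideal by (intro finsum_ideals_ideal) auto
    ultimately obtain M where M: "maximalideal M R" "?K \<subseteq> M"
      using exists_maximalideal_superset by blast
    have \<sigma>_M: "\<sigma> (I k) \<in> M" if k: "k \<in> {1..r}" for k
      using finsum_ideals_upper[of "{1..r}" "\<lambda>k. PIdl (\<sigma> (I k))" k] PIdl_ideal k M(2)
        cgenideal_self[OF \<sigma>_carr] by blast
    \<comment> \<open>\<open>M\<close> is any maximal ideal here, not necessarily in
      \<open>F\<close>. By primality it contains a factor \<open>s N e\<close> of
      \<open>\<sigma> (I k)\<close>. The exponent is nonzero since \<open>s N 0 = \<one>\<close>,
      and therefore \<open>I k\<close> lies in \<open>N\<close>.\<close>
    have factor: "\<exists>N\<in>F. I k \<subseteq> N \<and> (\<exists>e. s N e \<in> M)" if k: "k \<in> {1..r}" for k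
    proof -
      obtain Js where Js: "set Js \<subseteq> F" "I k = mk Js"
        using mkE I k by blast
      then have "finprod R (\<lambda>N. s N (count_list Js N)) F \<in> M"
        using \<sigma>_M[OF k] \<sigma>_mk by (simp add: t_def)
      then obtain N where N: "N \<in> F" "s N (count_list Js N) \<in> M"
        using finprod_notin_maximalideal[OF M(1), of "\<lambda>N. s N (count_list Js N)" F] s_carr by blast
      have "\<one> \<notin> M"
        using M(1) by (metis ideal.one_imp_carrier maximalideal.I_notcarr maximalideal.axioms(1))
      then have "count_list Js N \<noteq> 0"
        using N s0 by metis
      then show ?thesis
        using mk_sub_maximal Js N by blast
    qed
    \<comment> \<open>By \<open>s_coprime\<close> the ideal \<open>N\<close> is the same for all
      \<open>k\<close>. For \<open>r = 0\<close> any maximal ideal will do: the empty sum is the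
      zero ideal, which also contradicts \<open>sum\<close>.\<close>
    have "\<exists>N. maximalideal N R \<and> (\<forall>k\<in>{1..r}. I k \<subseteq> N)"
    proof (cases "{1..r} = {}")
      case True
      then show ?thesis
        using M(1) by blast
    next
      case False
      then obtain k e N where "k \<in> {1..r}" and N: "N \<in> F" "s N e \<in> M"
        using factor by blast
      have "I l \<subseteq> N" if "l \<in> {1..r}" for l
        using factor[OF that] s_coprime[OF _ N(1) M(1) _ N(2)] by blast
      then show ?thesis
        using N maxF by blast
    qed
    then obtain N where N: "maximalideal N R" "\<forall>k\<in>{1..r}. I k \<subseteq> N"
      by blast
    have "ideal (I k) R" if "k \<in> {1..r}" for k
      using mkE[of "I k"] mk_ideal I that by metis
    then have "(\<Oplus>\<^bsub>ideals_set R\<^esub> k \<in> {1..r}. I k) \<subseteq> N"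
      using N(2) by (intro finsum_ideals_least maximalideal.axioms(1)[OF N(1)]) auto
    then show False
      using sum maximalideal.I_notcarr[OF N(1)] ideal.Icarr[OF maximalideal.axioms(1)[OF N(1)]] by blast
  qed
  moreover have "\<sigma> \<in> ideal_monoid R F \<rightarrow> carrier R"
    unfolding \<sigma>_def using t_carr by blast
  ultimately show ?thesis
    by (intro bexI[of _ \<sigma>] conjI ballI allI impI)
qed

end
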